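(* Let $Q \subseteq L$, where $L$ is a real repeated radical extension of $Q$. If $|L:Q|$ is a power of $2$ and $K$ is a field with $Q \subseteq K \subseteq L$, then $K$ is a repeated radical extension of $Q$.
   Context: A field extension $F \subseteq L$ is a radical extension if $L = F[\alpha]$ for some $\alpha \in L$ with $\alpha^n \in F$ for some positive integer $n$. An extension $F \subseteq L$ is a repeated radical extension if there are intermediate fields $F = L_0 \subseteq L_1 \subseteq \cdots \subseteq L_r = L$ such that $L_i$ is a radical extension of $L_{i-1}$ for $0 < i \le r$. A real repeated radical extension of $Q$ is a repeated radical extension $L$ of $Q$ with $L \subseteq \mathbb{R}$. $|L:Q|$ denotes the degree of the field extension. *)

theory Defs
  imports Complex_Main "HOL-Algebra.Algebra" "HOL-Algebra.Algebraic_Closure_Type"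
begin

(* Both notions are relative to an ambient ring R, of which all the fields involved are
   subfields. In applications R is a field. *)

definition (in ring) radical_extension :: "'a set \<Rightarrow> 'a set \<Rightarrow> bool"
  where "radical_extension F L \<longleftrightarrow>
    subfield F R \<and> subfield L R \<and> F \<subseteq> L \<and>
    (\<exists>\<alpha> \<in> L. \<exists>n > (0::nat). \<alpha> [^] n \<in> F \<and> L = simple_extension F \<alpha>)"

(* For r = 0 the conditions reduce to: L = F is a subfield of R. *)

definition (in ring) repeated_radical_extension :: "'a set \<Rightarrow> 'a set \<Rightarrow> bool"
  where "repeated_radical_extension F L \<longleftrightarrow>
    (\<exists>(r::nat) (E :: nat \<Rightarrow> 'a set).
        E 0 = F \<and> E r = L \<and>
        (\<forall>i \<le> r. subfield (E i) R) \<and>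
        (\<forall>i. 0 < i \<and> i \<le> r \<longrightarrow> radical_extension (E (i - 1)) (E i)))"

abbreviation real_ring :: "real ring"
  where "real_ring \<equiv> ring_of_type_algebra"

end

theory Submission
  imports Defs
begin

text \<open>
  In characteristic zero a quadratic extension is a radical extension: it adjoins a square root. It is therefore
  enough to reach \<open>K\<close> from \<open>\<rat>\<close> by adjoining square roots one at a time.

  The field \<open>L\<close> is reached in this way. The degrees of the steps of its radical tower multiply to a power of two,
  so each degree \<open>m\<close> is a power of two. If a real \<open>x\<close> has a power in a real field \<open>F\<close> and has degree \<open>m\<close> over
  \<open>F\<close>, then its conjugates all have modulus \<open>\<bar>x\<bar>\<close>, the constant coefficient of its minimal polynomial is
  \<open>x ^ m\<close> or \<open>- x ^ m\<close>, and so \<open>x ^ m \<in> F\<close> (\<open>real_radical_power_dimension\<close>). For \<open>m = 2 ^ j\<close> this splits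
  \<open>F(x)\<close> into \<open>j\<close> adjunctions of square roots (\<open>real_radical_tower_is_sqrt_tower\<close>). The
  fields have to be real here, since a real number is determined up to sign by its modulus.

  It remains to show that a field between the ends of a tower of square roots is itself such a tower. The usual
  argument takes a Galois closure, whose group is a 2-group, and uses that a subgroup of a 2-group is subnormal
  with steps of index two. A direct descent in \<open>K\<close> avoids the closure. Let \<open>F(s)\<close> be the first step of the
  tower. By induction on the length of the tower, \<open>K(s)\<close> is a tower of square roots over \<open>F(s)\<close>. If
  \<open>s \<in> K\<close>, then \<open>K(s) = K\<close> and nothing is left to do. Otherwise the group of automorphisms of \<open>K(s)\<close> over
  \<open>F(s)\<close> is finite, and it contains an involution unless \<open>K = F\<close>; the conjugation of \<open>K(s)\<close> over
  \<open>K\<close> normalises it. Counting modulo two yields an involution that commutes with this conjugation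
  (\<open>commuting_involution\<close>). It restricts to \<open>K\<close>, and \<open>K\<close> is quadratic over the field that it fixes there
  (\<open>quadratic_subfield\<close>). That field contains \<open>F\<close> and is smaller than \<open>K\<close>, so the descent ends at \<open>F\<close>
  (\<open>intermediate_field_sqrt_tower\<close>).
\<close>

section \<open>Subfields of a type\<close>

lemma type_ring_sel [simp]:
  "carrier (ring_of_type_algebra :: 'a::comm_ring_1 ring) = UNIV"
  "x \<otimes>\<^bsub>ring_of_type_algebra\<^esub> y = (x * y :: 'a)"
  "x \<oplus>\<^bsub>ring_of_type_algebra\<^esub> y = (x + y :: 'a)"
  "\<one>\<^bsub>ring_of_type_algebra\<^esub> = (1 :: 'a)"
  "\<zero>\<^bsub>ring_of_type_algebra\<^esub> = (0 :: 'a)"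
  by (simp_all add: ring_of_type_algebra_def)

interpretation type_ring: domain "ring_of_type_algebra :: 'a::field ring"
  using field_from_type_algebra by (rule field.axioms)

abbreviation type_subfield :: "'a::field set \<Rightarrow> bool"
  where "type_subfield F \<equiv> subfield F ring_of_type_algebra"

lemma type_ring_pow [simp]: "(x::'a::field) [^]\<^bsub>ring_of_type_algebra\<^esub> (n::nat) = x ^ n"
  by (induction n) (simp_all add: mult.commute)

lemma type_ring_uminus [simp]: "\<ominus>\<^bsub>ring_of_type_algebra\<^esub> (x::'a::field) = - x"
  by (rule type_ring.minus_equality) auto

lemma type_ring_inv: "(x::'a::field) \<noteq> 0 \<Longrightarrow> inv\<^bsub>ring_of_type_algebra\<^esub> x = inverse x"
  by (rule type_ring.comm_inv_char) auto

lemma type_subfieldI: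
  fixes F :: "'a::field set"
  assumes "1 \<in> F"
    and "\<And>x y. x \<in> F \<Longrightarrow> y \<in> F \<Longrightarrow> x - y \<in> F"
    and "\<And>x y. x \<in> F \<Longrightarrow> y \<in> F \<Longrightarrow> x * y \<in> F"
    and "\<And>x. x \<in> F \<Longrightarrow> x \<noteq> 0 \<Longrightarrow> inverse x \<in> F"
  shows "type_subfield F"
proof (rule field.subfieldI'[OF field_from_type_algebra])
  have "0 \<in> F" using assms(1) assms(2)[of 1 1] by simp
  then have neg: "- x \<in> F" if "x \<in> F" for x using assms(2)[of 0 x] that by simp
  have add: "x + y \<in> F" if "x \<in> F" "y \<in> F" for x y
    using assms(2)[of x "- y"] neg that by simp
  show "subring F ring_of_type_algebra"
    using assms(1,3) neg add by (intro type_ring.subringI) auto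
  show "inv\<^bsub>ring_of_type_algebra\<^esub> k \<in> F" if "k \<in> F - {\<zero>\<^bsub>ring_of_type_algebra\<^esub>}" for k
    using that assms(4) by (auto simp: type_ring_inv)
qed

lemma type_subfieldE:
  fixes F :: "'a::field set"
  assumes "type_subfield F"
  shows zero_in_subfield: "0 \<in> F" and one_in_subfield: "1 \<in> F"
    and add_in_subfield: "\<And>x y. x \<in> F \<Longrightarrow> y \<in> F \<Longrightarrow> x + y \<in> F"
    and uminus_in_subfield: "\<And>x. x \<in> F \<Longrightarrow> - x \<in> F"
    and diff_in_subfield: "\<And>x y. x \<in> F \<Longrightarrow> y \<in> F \<Longrightarrow> x - y \<in> F"
    and mult_in_subfield: "\<And>x y. x \<in> F \<Longrightarrow> y \<in> F \<Longrightarrow> x * y \<in> F"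
    and inverse_in_subfield: "\<And>x. x \<in> F \<Longrightarrow> inverse x \<in> F"
    and divide_in_subfield: "\<And>x y. x \<in> F \<Longrightarrow> y \<in> F \<Longrightarrow> x / y \<in> F"
    and power_in_subfield: "\<And>x n. x \<in> F \<Longrightarrow> x ^ n \<in> F"
proof -
  note sub = subringE[OF subfieldE(1)[OF assms]]
  show zero: "0 \<in> F" and one: "1 \<in> F" using sub(2,3) by simp_all
  show add: "x + y \<in> F" if "x \<in> F" "y \<in> F" for x y using sub(7)[OF that] by simp
  show um: "- x \<in> F" if "x \<in> F" for x using sub(5)[OF that] by simp
  show "x - y \<in> F" if "x \<in> F" "y \<in> F" for x y using add[of x "- y"] um that by simp
  show mult: "x * y \<in> F" if "x \<in> F" "y \<in> F" for x y using sub(6)[OF that] by simp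
  show inv: "inverse x \<in> F" if "x \<in> F" for x
    using type_ring.subfield_m_inv(1)[OF assms, of x] that zero by (cases "x = 0") (auto simp: type_ring_inv)
  show "x / y \<in> F" if "x \<in> F" "y \<in> F" for x y
    using mult inv that by (simp add: divide_inverse)
  show "x ^ n \<in> F" if "x \<in> F" for x n
    using that one mult by (induction n) auto
qed

lemmas subfield_closed = zero_in_subfield one_in_subfield add_in_subfield uminus_in_subfield
  diff_in_subfield mult_in_subfield inverse_in_subfield divide_in_subfield power_in_subfield

section \<open>Adjoining square roots\<close>

definition adjoin_sqrt :: "'a::field set \<Rightarrow> 'a \<Rightarrow> 'a set"
  where "adjoin_sqrt F s = {a + b * s |a b. a \<in> F \<and> b \<in> F}"

lemma adjoin_sqrtI: "x = a + b * s \<Longrightarrow> a \<in> F \<Longrightarrow> b \<in> F \<Longrightarrow> x \<in> adjoin_sqrt F s"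
  by (auto simp: adjoin_sqrt_def)

lemma adjoin_sqrtE:
  assumes "x \<in> adjoin_sqrt F s"
  obtains a b where "a \<in> F" "b \<in> F" "x = a + b * s"
  using assms by (auto simp: adjoin_sqrt_def)

lemma subset_adjoin_sqrt: "type_subfield F \<Longrightarrow> F \<subseteq> adjoin_sqrt F s"
  using adjoin_sqrtI[of _ _ 0 s F] by (auto simp: subfield_closed)

lemma mem_adjoin_sqrt: "type_subfield F \<Longrightarrow> s \<in> adjoin_sqrt F s"
  using adjoin_sqrtI[of s 0 1 s F] by (auto simp: subfield_closed)

lemma adjoin_sqrt_least:
  "type_subfield K \<Longrightarrow> F \<subseteq> K \<Longrightarrow> s \<in> K \<Longrightarrow> adjoin_sqrt F s \<subseteq> K"
  by (auto simp: adjoin_sqrt_def intro!: subfield_closed)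

lemma adjoin_sqrt_trivial: "type_subfield F \<Longrightarrow> s \<in> F \<Longrightarrow> adjoin_sqrt F s = F"
  by (simp add: adjoin_sqrt_least subset_adjoin_sqrt subset_antisym)

lemma adjoin_sqrt_unique:
  assumes F: "type_subfield F" and s: "s \<notin> F"
    and mem: "a \<in> F" "b \<in> F" "a' \<in> F" "b' \<in> F" and eq: "a + b * s = a' + b' * s"
  shows "a = a'" "b = b'"
proof -
  show "b = b'"
  proof (rule ccontr)
    assume "b \<noteq> b'"
    then have "s = (a' - a) / (b - b')" using eq by (simp add: field_simps)
    moreover have "(a' - a) / (b - b') \<in> F" using F mem by (simp add: subfield_closed)
    ultimately show False using s by simp
  qed
  then show "a = a'" using eq by simp
qed

text \<open>The inverse is found by rationalising the denominator. The conjugate \<open>a - b * s\<close> vanishes only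
  together with \<open>a + b * s\<close>, since the representation is unique when \<open>s \<notin> F\<close>.\<close>

lemma subfield_adjoin_sqrt:
  assumes F: "type_subfield F" and s: "s ^ 2 \<in> F"
  shows "type_subfield (adjoin_sqrt F s)"
proof (cases "s \<in> F")
  case True
  then show ?thesis using F by (simp add: adjoin_sqrt_trivial)
next
  case False
  show ?thesis
  proof (rule type_subfieldI)
    show "1 \<in> adjoin_sqrt F s" using subset_adjoin_sqrt[OF F] one_in_subfield[OF F] by blast
    fix x assume "x \<in> adjoin_sqrt F s"
    then obtain a b where x: "a \<in> F" "b \<in> F" "x = a + b * s" by (rule adjoin_sqrtE)
    show "x - y \<in> adjoin_sqrt F s" "x * y \<in> adjoin_sqrt F s" if y: "y \<in> adjoin_sqrt F s" for y
    proof -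
      obtain c d where y: "c \<in> F" "d \<in> F" "y = c + d * s" using y by (rule adjoin_sqrtE)
      have "x - y = (a - c) + (b - d) * s" by (simp add: x y algebra_simps)
      then show "x - y \<in> adjoin_sqrt F s"
        using F x y by (elim adjoin_sqrtI) (simp_all add: subfield_closed)
      have "x * y = (a * c + b * d * s ^ 2) + (a * d + b * c) * s"
        by (simp add: x y algebra_simps power2_eq_square)
      then show "x * y \<in> adjoin_sqrt F s"
        using F x y s by (elim adjoin_sqrtI) (simp_all add: subfield_closed)
    qed
    assume "x \<noteq> 0"
    have conj: "a - b * s \<noteq> 0"
      using adjoin_sqrt_unique[OF F False, of a "- b" 0 0] x \<open>x \<noteq> 0\<close> F
      by (auto simp: subfield_closed)
    define N where "N = a ^ 2 - b ^ 2 * s ^ 2"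
    have N: "x * (a - b * s) = N"
      by (simp add: x N_def algebra_simps power2_eq_square)
    have "inverse x = a / N + (- b / N) * s"
    proof -
      have "inverse x = (a - b * s) / (x * (a - b * s))"
        using conj by (simp add: inverse_eq_divide)
      also have "\<dots> = a / N + (- b / N) * s"
        unfolding N by (simp add: diff_divide_distrib)
      finally show ?thesis .
    qed
    moreover have "N \<in> F" using F x s by (simp add: N_def subfield_closed)
    ultimately show "inverse x \<in> adjoin_sqrt F s"
      using F x by (elim adjoin_sqrtI) (simp_all add: subfield_closed)
  qed
qed

lemma simple_extension_eq_adjoin_sqrt:
  assumes F: "type_subfield F" and s: "s ^ 2 \<in> F"
  shows "ring.simple_extension ring_of_type_algebra F s = adjoin_sqrt F s"
proof
  show "ring.simple_extension ring_of_type_algebra F s \<subseteq> adjoin_sqrt F s"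
    using subfieldE(1)[OF subfield_adjoin_sqrt[OF F s]] subset_adjoin_sqrt[OF F]
      mem_adjoin_sqrt[OF F] by (rule type_ring.simple_extension_subring_incl)
  show "adjoin_sqrt F s \<subseteq> ring.simple_extension ring_of_type_algebra F s"
  proof
    fix x assume "x \<in> adjoin_sqrt F s"
    then obtain a b where x: "a \<in> F" "b \<in> F" "x = a + b * s" by (rule adjoin_sqrtE)
    have "b \<in> ring.simple_extension ring_of_type_algebra F s"
      using type_ring.simple_extension_incl[of F s] x by auto
    from type_ring.simple_extension.lin[OF this x(1)]
    show "x \<in> ring.simple_extension ring_of_type_algebra F s"
      by (simp add: x add.commute)
  qed
qed

text \<open>The case \<open>s \<in> F\<close> is admitted: when a root is adjoined, it need not be known whether the degree is one
  or two.\<close>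

definition quad_step :: "'a::field set \<Rightarrow> 'a set \<Rightarrow> bool"
  where "quad_step F E \<longleftrightarrow> type_subfield F \<and> (\<exists>s. s ^ 2 \<in> F \<and> E = adjoin_sqrt F s)"

abbreviation sqrt_tower :: "'a::field set \<Rightarrow> 'a set \<Rightarrow> bool"
  where "sqrt_tower \<equiv> quad_step\<^sup>*\<^sup>*"

lemma quad_step_subfield: "quad_step F E \<Longrightarrow> type_subfield E"
  by (auto simp: quad_step_def subfield_adjoin_sqrt)

lemma quad_step_subset: "quad_step F E \<Longrightarrow> F \<subseteq> E"
  by (auto simp: quad_step_def dest: subset_adjoin_sqrt)

lemma sqrt_tower_subfield: "sqrt_tower F E \<Longrightarrow> type_subfield F \<Longrightarrow> type_subfield E"
  by (induction rule: rtranclp_induct) (auto dest: quad_step_subfield)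

lemma sqrt_tower_subset: "sqrt_tower F E \<Longrightarrow> F \<subseteq> E"
  by (induction rule: rtranclp_induct) (auto dest: quad_step_subset)

text \<open>Trivial steps at the top of a tower can be dropped, and the last one that remains provides a quadratic
  conjugation of the top field.\<close>

lemma sqrt_tower_last_step:
  assumes "sqrt_tower F E" "F \<noteq> E"
  obtains N t where "sqrt_tower F N" "type_subfield N" "t ^ 2 \<in> N" "t \<notin> N" "E = adjoin_sqrt N t"
  using assms
proof (induction arbitrary: thesis rule: rtranclp_induct)
  case (step N E)
  then obtain t where t: "type_subfield N" "t ^ 2 \<in> N" "E = adjoin_sqrt N t"
    by (auto simp: quad_step_def)
  show ?case
  proof (cases "t \<in> N")
    case True
    then have "E = N" using t by (simp add: adjoin_sqrt_trivial)
    then show ?thesis using step by metis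
  next
    case False
    then show ?thesis using step t by blast
  qed
qed auto

lemma sqrt_tower_finite_dimension:
  assumes "sqrt_tower F E" "type_subfield F"
  shows "ring.finite_dimension ring_of_type_algebra F E"
  using assms
proof (induction rule: rtranclp_induct)
  case base
  then show ?case using type_ring.dimension_one type_ring.finite_dimensionI by blast
next
  case (step M E)
  then obtain t where t: "type_subfield M" "t ^ 2 \<in> M" "E = adjoin_sqrt M t"
    by (auto simp: quad_step_def)
  have E: "E = ring.simple_extension ring_of_type_algebra M t"
    using t by (simp add: simple_extension_eq_adjoin_sqrt)
  have "type_subfield E" using step.hyps(2) by (rule quad_step_subfield)
  then have "ring.finite_dimension ring_of_type_algebra M E"
    unfolding E using type_ring.finite_dimension_simple_extension[OF t(1), of t]
      type_ring.simple_extension_is_subfield[OF t(1), of t] by simp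
  then show ?case
    using type_ring.telescopic_base_dim(1)[OF step.prems t(1) step.IH[OF step.prems]] by blast
qed

section \<open>Automorphisms of towers of square roots\<close>

definition hom_on :: "'a::field set \<Rightarrow> ('a \<Rightarrow> 'a) \<Rightarrow> bool"
  where "hom_on E \<sigma> \<longleftrightarrow> (\<forall>x\<in>E. \<forall>y\<in>E. \<sigma> (x + y) = \<sigma> x + \<sigma> y \<and> \<sigma> (x * y) = \<sigma> x * \<sigma> y)"

lemma hom_on_add: "hom_on E \<sigma> \<Longrightarrow> x \<in> E \<Longrightarrow> y \<in> E \<Longrightarrow> \<sigma> (x + y) = \<sigma> x + \<sigma> y"
  and hom_on_mult: "hom_on E \<sigma> \<Longrightarrow> x \<in> E \<Longrightarrow> y \<in> E \<Longrightarrow> \<sigma> (x * y) = \<sigma> x * \<sigma> y"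
  by (simp_all add: hom_on_def)

lemma hom_on_subset: "hom_on E \<sigma> \<Longrightarrow> F \<subseteq> E \<Longrightarrow> hom_on F \<sigma>"
  by (auto simp: hom_on_def)

text \<open>Automorphisms of \<open>E\<close> are extended by the identity outside \<open>E\<close>. They are then permutations of the whole
  type, so that equality of automorphisms is equality of functions and composition is \<open>\<circ>\<close>.\<close>

definition automorphisms :: "'a::field set \<Rightarrow> 'a set \<Rightarrow> ('a \<Rightarrow> 'a) set"
  where "automorphisms F E = {\<sigma>. \<sigma> permutes E \<and> hom_on E \<sigma> \<and> (\<forall>x\<in>F. \<sigma> x = x)}"

lemma automorphismsD:
  assumes "\<sigma> \<in> automorphisms F E"
  shows "\<sigma> permutes E" "hom_on E \<sigma>" "\<And>x. x \<in> F \<Longrightarrow> \<sigma> x = x"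
    "\<And>x. x \<notin> E \<Longrightarrow> \<sigma> x = x" "\<And>x. \<sigma> x \<in> E \<longleftrightarrow> x \<in> E"
  using assms by (auto simp: automorphisms_def permutes_not_in permutes_in_image)

lemma id_automorphism: "id \<in> automorphisms F E"
  by (simp add: automorphisms_def hom_on_def permutes_id)

lemma comp_automorphism:
  assumes "\<sigma> \<in> automorphisms F E" "\<tau> \<in> automorphisms F E"
  shows "\<sigma> \<circ> \<tau> \<in> automorphisms F E"
  using automorphismsD[OF assms(1)] automorphismsD[OF assms(2)]
  by (simp add: automorphisms_def hom_on_def permutes_compose)

lemma inv_automorphism:
  assumes E: "type_subfield E" and FE: "F \<subseteq> E" and \<sigma>: "\<sigma> \<in> automorphisms F E"
  shows "inv_into UNIV \<sigma> \<in> automorphisms F E"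
proof -
  note D = automorphismsD[OF \<sigma>]
  have inv: "inv_into UNIV \<sigma> (\<sigma> x) = x" "\<sigma> (inv_into UNIV \<sigma> x) = x" for x
    using permutes_inverses[OF D(1)] by simp_all
  have mem: "inv_into UNIV \<sigma> x \<in> E" if "x \<in> E" for x
    using that D(5)[of "inv_into UNIV \<sigma> x"] inv by simp
  have "hom_on E (inv_into UNIV \<sigma>)"
    unfolding hom_on_def
  proof (intro ballI conjI)
    fix x y assume xy: "x \<in> E" "y \<in> E"
    have "x + y = \<sigma> (inv_into UNIV \<sigma> x + inv_into UNIV \<sigma> y)" "x * y = \<sigma> (inv_into UNIV \<sigma> x * inv_into UNIV \<sigma> y)"
      using D(2) mem xy by (simp_all add: hom_on_add hom_on_mult inv)
    then show "inv_into UNIV \<sigma> (x + y) = inv_into UNIV \<sigma> x + inv_into UNIV \<sigma> y" "inv_into UNIV \<sigma> (x * y) = inv_into UNIV \<sigma> x * inv_into UNIV \<sigma> y"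
      by (simp_all add: inv)
  qed
  moreover have "inv_into UNIV \<sigma> x = x" if "x \<in> F" for x
    using inv(1)[of x] D(3)[OF that] by simp
  ultimately show ?thesis
    using permutes_inv[OF D(1)] by (simp add: automorphisms_def)
qed

lemma hom_on_uminus:
  assumes E: "type_subfield E" and \<sigma>: "hom_on E \<sigma>" and x: "x \<in> E"
  shows "\<sigma> (- x) = - \<sigma> x"
proof -
  have "\<sigma> 0 + \<sigma> 0 = \<sigma> 0"
    using hom_on_add[OF \<sigma>, of 0 0] E by (simp add: subfield_closed)
  then have "\<sigma> 0 = 0" by (metis add_cancel_right_right)
  moreover have "\<sigma> (x + - x) = \<sigma> x + \<sigma> (- x)"
    using \<sigma> x uminus_in_subfield[OF E x] by (rule hom_on_add)
  ultimately show ?thesis by (simp add: eq_neg_iff_add_eq_0 add.commute)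
qed

lemma hom_on_diff:
  assumes E: "type_subfield E" and \<sigma>: "hom_on E \<sigma>" and x: "x \<in> E" "y \<in> E"
  shows "\<sigma> (x - y) = \<sigma> x - \<sigma> y"
  using hom_on_add[OF \<sigma>, of x "- y"] hom_on_uminus[OF E \<sigma>, of y] E x
  by (simp add: subfield_closed)

lemma finite_square_roots: "finite {t::'a::idom. t ^ 2 = c}"
proof (cases "\<exists>u. u ^ 2 = c")
  case True
  then obtain u where "u ^ 2 = c" by blast
  then have "{t. t ^ 2 = c} \<subseteq> {u, - u}" by (auto simp: power2_eq_iff)
  then show ?thesis by (rule finite_subset) simp
qed simp

text \<open>A homomorphism prescribed on \<open>F\<close> extends to \<open>F(s)\<close> in at most two ways, because the image of \<open>s\<close> is a
  square root of the image of \<open>s ^ 2\<close>. The prescribed values \<open>\<theta>\<close> have to be arbitrary for the induction,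
  which passes from \<open>F\<close> to \<open>F(s)\<close>.\<close>

lemma finite_hom_extensions:
  assumes "sqrt_tower F E" "type_subfield F"
  shows "finite {\<sigma>. hom_on E \<sigma> \<and> (\<forall>x\<in>F. \<sigma> x = \<theta> x) \<and> (\<forall>x. x \<notin> E \<longrightarrow> \<sigma> x = x)}"
  using assms
proof (induction arbitrary: \<theta> rule: converse_rtranclp_induct)
  case base
  have "{\<sigma>. hom_on E \<sigma> \<and> (\<forall>x\<in>E. \<sigma> x = \<theta> x) \<and> (\<forall>x. x \<notin> E \<longrightarrow> \<sigma> x = x)}
    \<subseteq> {\<lambda>x. if x \<in> E then \<theta> x else x}"
    by auto
  then show ?case by (rule finite_subset) simp
next
  case (step F F')
  obtain s where s: "s ^ 2 \<in> F" "F' = adjoin_sqrt F s"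
    using step.hyps(1) by (auto simp: quad_step_def)
  have F': "type_subfield F'" using step.hyps(1) by (rule quad_step_subfield)
  have FF': "F \<subseteq> F'" and sF': "s \<in> F'"
    using s step.prems by (simp_all add: subset_adjoin_sqrt mem_adjoin_sqrt)
  have F'E: "F' \<subseteq> E" using step.hyps(2) by (rule sqrt_tower_subset)
  \<comment> \<open>Sort the extensions by the image \<open>t\<close> of \<open>s\<close>; any two in one class agree on all of \<open>F'\<close>.\<close>
  define H where "H t = {\<sigma>. hom_on E \<sigma> \<and> (\<forall>x\<in>F. \<sigma> x = \<theta> x) \<and> \<sigma> s = t \<and> (\<forall>x. x \<notin> E \<longrightarrow> \<sigma> x = x)}" for t
  have "finite (H t)" for t
  proof (cases "H t = {}")
    case False
    then obtain \<sigma>0 where \<sigma>0: "\<sigma>0 \<in> H t" by blast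
    have "\<sigma> x = \<sigma>0 x" if \<sigma>: "\<sigma> \<in> H t" and x: "x \<in> F'" for \<sigma> x
    proof -
      obtain a b where ab: "a \<in> F" "b \<in> F" "x = a + b * s"
        using x unfolding s(2) by (rule adjoin_sqrtE)
      have E: "a \<in> E" "b \<in> E" "s \<in> E" "b * s \<in> E"
        using ab sF' FF' F'E mult_in_subfield[OF F'] by blast+
      have val: "\<rho> x = \<theta> a + \<theta> b * t" if "\<rho> \<in> H t" for \<rho>
      proof -
        have \<rho>: "hom_on E \<rho>" "\<rho> a = \<theta> a" "\<rho> b = \<theta> b" "\<rho> s = t"
          using that ab by (auto simp: H_def)
        then show ?thesis
          using E by (simp add: ab(3) hom_on_add[OF \<rho>(1)] hom_on_mult[OF \<rho>(1)])
      qed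
      show ?thesis using val[OF \<sigma>] val[OF \<sigma>0] by simp
    qed
    then have "H t \<subseteq> {\<sigma>. hom_on E \<sigma> \<and> (\<forall>x\<in>F'. \<sigma> x = \<sigma>0 x) \<and> (\<forall>x. x \<notin> E \<longrightarrow> \<sigma> x = x)}"
      by (auto simp: H_def)
    then show ?thesis using step.IH[OF F'] by (rule finite_subset)
  qed simp
  then have "finite (\<Union>t\<in>{t. t ^ 2 = \<theta> (s ^ 2)}. H t)"
    by (simp add: finite_square_roots)
  moreover have "{\<sigma>. hom_on E \<sigma> \<and> (\<forall>x\<in>F. \<sigma> x = \<theta> x) \<and> (\<forall>x. x \<notin> E \<longrightarrow> \<sigma> x = x)}
    \<subseteq> (\<Union>t\<in>{t. t ^ 2 = \<theta> (s ^ 2)}. H t)"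
  proof
    fix \<sigma> assume \<sigma>: "\<sigma> \<in> {\<sigma>. hom_on E \<sigma> \<and> (\<forall>x\<in>F. \<sigma> x = \<theta> x) \<and> (\<forall>x. x \<notin> E \<longrightarrow> \<sigma> x = x)}"
    have "\<sigma> s ^ 2 = \<sigma> (s ^ 2)"
      using \<sigma> sF' F'E by (auto simp: power2_eq_square hom_on_mult)
    then show "\<sigma> \<in> (\<Union>t\<in>{t. t ^ 2 = \<theta> (s ^ 2)}. H t)"
      using \<sigma> s(1) by (auto simp: H_def)
  qed
  ultimately show ?case by (rule rev_finite_subset)
qed

corollary finite_automorphisms:
  assumes "sqrt_tower F E" "type_subfield F"
  shows "finite (automorphisms F E)"
  by (rule finite_subset[OF _ finite_hom_extensions[OF assms, of id]]) (auto dest: automorphismsD)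

text \<open>The map \<open>a + b * s \<mapsto> a - b * s\<close> is well defined since \<open>s \<notin> F\<close>; it fixes only the elements of \<open>F\<close>
  because \<open>2 \<noteq> 0\<close>.\<close>

lemma sqrt_conjugation:
  fixes s :: "'a::field_char_0"
  assumes F: "type_subfield F" and s: "s ^ 2 \<in> F" "s \<notin> F"
  obtains \<sigma> where "\<sigma> \<in> automorphisms F (adjoin_sqrt F s)" "\<sigma> s = - s" "\<sigma> \<circ> \<sigma> = id"
    "\<And>x. x \<in> adjoin_sqrt F s \<Longrightarrow> \<sigma> x = x \<Longrightarrow> x \<in> F"
proof -
  let ?E = "adjoin_sqrt F s"
  define \<sigma> where "\<sigma> x = (if x \<in> ?E then SOME y. \<exists>a\<in>F. \<exists>b\<in>F. x = a + b * s \<and> y = a - b * s else x)" for x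
  have \<sigma>: "\<sigma> (a + b * s) = a - b * s" if "a \<in> F" "b \<in> F" for a b
  proof -
    have "\<sigma> (a + b * s) = (SOME y. \<exists>a'\<in>F. \<exists>b'\<in>F. a + b * s = a' + b' * s \<and> y = a' - b' * s)"
      using that adjoin_sqrtI[OF refl that, of s] by (simp add: \<sigma>_def)
    also have "\<dots> = a - b * s"
    proof (rule some_equality)
      show "\<exists>a'\<in>F. \<exists>b'\<in>F. a + b * s = a' + b' * s \<and> a - b * s = a' - b' * s"
        using that by blast
      show "y = a - b * s" if "\<exists>a'\<in>F. \<exists>b'\<in>F. a + b * s = a' + b' * s \<and> y = a' - b' * s" for y
        using that adjoin_sqrt_unique[OF F s(2) \<open>a \<in> F\<close> \<open>b \<in> F\<close>] by auto
    qed
    finally show ?thesis .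
  qed
  have out: "\<sigma> x = x" if "x \<notin> ?E" for x using that by (simp add: \<sigma>_def)
  have mem: "\<sigma> x \<in> ?E" if x: "x \<in> ?E" for x
  proof -
    obtain a b where ab: "a \<in> F" "b \<in> F" "x = a + b * s" using x by (rule adjoin_sqrtE)
    have "\<sigma> x = a + (- b) * s" using \<sigma>[OF ab(1,2)] ab(3) by simp
    then show ?thesis using ab F by (elim adjoin_sqrtI) (simp_all add: subfield_closed)
  qed
  have invol: "\<sigma> (\<sigma> x) = x" for x
  proof (cases "x \<in> ?E")
    case True
    then obtain a b where ab: "a \<in> F" "b \<in> F" "x = a + b * s" by (rule adjoin_sqrtE)
    then show ?thesis using \<sigma>[of a b] \<sigma>[of a "- b"] F by (simp add: subfield_closed)
  qed (simp add: out)
  have "\<sigma> permutes ?E"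
    unfolding permutes_def using out invol by metis
  moreover have "hom_on ?E \<sigma>"
    unfolding hom_on_def
  proof (intro ballI)
    fix x y assume "x \<in> ?E" "y \<in> ?E"
    then obtain a b c d where x: "a \<in> F" "b \<in> F" "x = a + b * s" and y: "c \<in> F" "d \<in> F" "y = c + d * s"
      by (elim adjoin_sqrtE) blast
    have "x + y = (a + c) + (b + d) * s" "x * y = (a * c + b * d * s ^ 2) + (a * d + b * c) * s"
      by (simp_all add: x y algebra_simps power2_eq_square)
    then show "\<sigma> (x + y) = \<sigma> x + \<sigma> y \<and> \<sigma> (x * y) = \<sigma> x * \<sigma> y"
      using \<sigma>[of "a + c" "b + d"] \<sigma>[of "a * c + b * d * s ^ 2" "a * d + b * c"] \<sigma>[OF x(1,2)] \<sigma>[OF y(1,2)]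
        x y s(1) F by (simp add: subfield_closed) (simp add: algebra_simps power2_eq_square)
  qed
  moreover have "\<sigma> x = x" if "x \<in> F" for x
    using \<sigma>[of x 0] that F by (simp add: subfield_closed)
  ultimately have "\<sigma> \<in> automorphisms F ?E" by (simp add: automorphisms_def)
  moreover have "\<sigma> s = - s"
    using \<sigma>[of 0 1] F by (simp add: subfield_closed)
  moreover have "x \<in> F" if x: "x \<in> ?E" "\<sigma> x = x" for x
  proof -
    obtain a b where ab: "a \<in> F" "b \<in> F" "x = a + b * s" using x(1) by (rule adjoin_sqrtE)
    then have "- b = b"
      using x(2) \<sigma>[of a b] F adjoin_sqrt_unique(2)[OF F s(2), of a "- b" a b]
      by (simp add: subfield_closed)
    then show ?thesis using ab by simp
  qed
  moreover have "\<sigma> \<circ> \<sigma> = id" using invol by (simp add: fun_eq_iff)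
  ultimately show thesis using that by blast
qed

section \<open>An involution that descends\<close>

text \<open>The points that an involution moves come in pairs.\<close>

lemma even_card_iff_even_fixed_points:
  assumes "finite A" and "\<And>x. x \<in> A \<Longrightarrow> f x \<in> A" and "\<And>x. x \<in> A \<Longrightarrow> f (f x) = x"
  shows "even (card A) \<longleftrightarrow> even (card {x \<in> A. f x = x})"
  using assms
proof (induction A rule: finite_psubset_induct)
  case (psubset A)
  show ?case
  proof (cases "\<forall>x\<in>A. f x = x")
    case True
    then have "{x \<in> A. f x = x} = A" by blast
    then show ?thesis by simp
  next
    case False
    then obtain x where x: "x \<in> A" "f x \<noteq> x" by blast
    define B where "B = A - {x, f x}"
    have fx: "f x \<in> A" "f (f x) = x" using psubset.prems x by simp_all
    have clo: "f y \<in> B" if y: "y \<in> B" for y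
    proof -
      have "f y \<noteq> x" "f y \<noteq> f x" using y psubset.prems(2)[of y] fx by (auto simp: B_def)
      then show ?thesis using y psubset.prems(1)[of y] by (auto simp: B_def)
    qed
    have A: "A = insert x (insert (f x) B)" using x fx by (auto simp: B_def)
    have "even (card A) \<longleftrightarrow> even (card B)"
      using psubset.hyps x fx by (subst A) (simp add: B_def)
    also have "\<dots> \<longleftrightarrow> even (card {y \<in> B. f y = y})"
      using x clo psubset.prems by (intro psubset.IH) (auto simp: B_def)
    also have "{y \<in> B. f y = y} = {y \<in> A. f y = y}"
      using x fx by (auto simp: B_def)
    finally show ?thesis .
  qed
qed

text \<open>Parity is used three times. Multiplication by \<open>\<tau>\<close> has no fixed point on \<open>G\<close>, so \<open>G\<close> has even order.
  Conjugation by \<open>\<sigma>\<close> is an involution of \<open>G\<close>, so the centraliser of \<open>\<sigma>\<close> in \<open>G\<close> has even order. Inversion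
  is an involution of this centraliser, so the elements of order at most two in it are even in number; the
  identity is one of them, hence there is another one.\<close>

lemma commuting_involution:
  fixes G :: "('a \<Rightarrow> 'a) set"
  assumes fin: "finite G" and G_id: "id \<in> G" and comp: "\<And>x y. x \<in> G \<Longrightarrow> y \<in> G \<Longrightarrow> x \<circ> y \<in> G"
    and inv: "\<And>x. x \<in> G \<Longrightarrow> inv_into UNIV x \<in> G" and bij: "\<And>x. x \<in> G \<Longrightarrow> bij x"
    and \<tau>: "\<tau> \<in> G" "\<tau> \<noteq> id" "\<tau> \<circ> \<tau> = id"
    and \<sigma>: "\<sigma> \<circ> \<sigma> = id" "\<And>x. x \<in> G \<Longrightarrow> \<sigma> \<circ> x \<circ> \<sigma> \<in> G"
  obtains \<rho> where "\<rho> \<in> G" "\<rho> \<noteq> id" "\<rho> \<circ> \<rho> = id" "\<rho> \<circ> \<sigma> = \<sigma> \<circ> \<rho>"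
proof -
  have \<sigma>\<sigma>: "\<sigma> (\<sigma> a) = a" and \<tau>\<tau>: "\<tau> (\<tau> a) = a" for a
    using \<sigma>(1) \<tau>(3) by (simp_all add: fun_eq_iff)
  have no_fixed: "{x \<in> G. \<tau> \<circ> x = x} = {}"
  proof -
    have False if x: "x \<in> G" "\<tau> \<circ> x = x" for x
    proof -
      have "\<tau> = (\<tau> \<circ> x) \<circ> inv_into UNIV x"
        using bij[OF x(1)] by (simp add: fun_eq_iff bij_is_surj surj_f_inv_f)
      also have "\<dots> = id" using bij[OF x(1)] by (simp add: x(2) fun_eq_iff bij_is_surj surj_f_inv_f)
      finally show False using \<tau>(2) by simp
    qed
    then show ?thesis by blast
  qed
  have "even (card G) \<longleftrightarrow> even (card {x \<in> G. \<tau> \<circ> x = x})"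
    by (rule even_card_iff_even_fixed_points) (use fin comp \<tau> in \<open>auto simp: fun_eq_iff\<close>)
  then have "even (card G)" unfolding no_fixed by simp
  define C where "C = {x \<in> G. \<sigma> \<circ> x \<circ> \<sigma> = x}"
  have "even (card C)"
    using \<open>even (card G)\<close> unfolding C_def
    by (subst (asm) even_card_iff_even_fixed_points[of G "\<lambda>x. \<sigma> \<circ> x \<circ> \<sigma>"])
      (use fin \<sigma> in \<open>auto simp: fun_eq_iff\<close>)
  have C_inv: "inv_into UNIV x \<in> C" if x: "x \<in> C" for x
  proof -
    have bx: "bij x" and G: "x \<in> G" and cx: "\<sigma> (x (\<sigma> a)) = x a" for a
      using x bij by (auto simp: C_def fun_eq_iff)
    have "\<sigma> (inv_into UNIV x (\<sigma> a)) = inv_into UNIV x a" for a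
    proof -
      have "x (\<sigma> (inv_into UNIV x (\<sigma> a))) = \<sigma> (x (inv_into UNIV x (\<sigma> a)))"
        using cx[of "\<sigma> (inv_into UNIV x (\<sigma> a))"] by (simp add: \<sigma>\<sigma>)
      also have "\<dots> = a" using bx by (simp add: bij_is_surj surj_f_inv_f \<sigma>\<sigma>)
      finally show ?thesis using bx by (metis bij_inv_eq_iff)
    qed
    then show ?thesis using inv[OF G] by (simp add: C_def fun_eq_iff)
  qed
  have "even (card C) \<longleftrightarrow> even (card {x \<in> C. inv_into UNIV x = x})"
    by (rule even_card_iff_even_fixed_points)
      (use fin C_inv bij in \<open>auto simp: C_def inv_inv_eq\<close>)
  with \<open>even (card C)\<close> have ev: "even (card {x \<in> C. inv_into UNIV x = x})" by simp
  have "id \<in> {x \<in> C. inv_into UNIV x = x}" using G_id \<sigma>(1) by (simp add: C_def)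
  moreover have "{x \<in> C. inv_into UNIV x = x} \<noteq> {id}" using ev by auto
  ultimately obtain \<rho> where \<rho>: "\<rho> \<in> C" "inv_into UNIV \<rho> = \<rho>" "\<rho> \<noteq> id" by blast
  have "\<rho> \<in> G" and comm: "\<sigma> (\<rho> (\<sigma> a)) = \<rho> a" for a using \<rho>(1) by (auto simp: C_def fun_eq_iff)
  moreover have "\<rho> \<circ> \<rho> = id"
    using bij[OF \<open>\<rho> \<in> G\<close>] \<rho>(2) by (metis bij_is_inj inv_o_cancel)
  moreover have "\<rho> \<circ> \<sigma> = \<sigma> \<circ> \<rho>"
    using comm \<sigma>\<sigma> by (metis comp_apply ext)
  ultimately show thesis using that \<rho>(3) by blast
qed

text \<open>With \<open>t = u - \<rho> u\<close> one has \<open>\<rho> t = - t\<close>, so \<open>t ^ 2\<close> is fixed. An element \<open>y\<close> is half the sum of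
  \<open>y + \<rho> y\<close>, which is fixed, and \<open>y - \<rho> y\<close>, which is \<open>t\<close> times a fixed element.\<close>

lemma quad_step_fixed_field:
  fixes K :: "'a::field_char_0 set"
  assumes K: "type_subfield K" and \<rho>: "hom_on K \<rho>" and clo: "\<And>x. x \<in> K \<Longrightarrow> \<rho> x \<in> K"
    and invol: "\<And>x. x \<in> K \<Longrightarrow> \<rho> (\<rho> x) = x" and one: "\<rho> 1 = 1"
    and nontriv: "u \<in> K" "\<rho> u \<noteq> u"
  shows "quad_step {x \<in> K. \<rho> x = x} K"
proof -
  let ?M = "{x \<in> K. \<rho> x = x}"
  have M: "type_subfield ?M"
  proof (rule type_subfieldI)
    show "1 \<in> ?M" using one K by (simp add: subfield_closed)
    show "x - y \<in> ?M" "x * y \<in> ?M" if "x \<in> ?M" "y \<in> ?M" for x y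
      using that K hom_on_diff[OF K \<rho>] hom_on_mult[OF \<rho>] by (auto simp: subfield_closed)
    fix x assume x: "x \<in> ?M" "x \<noteq> 0"
    then have "inverse x \<in> K" using K by (simp add: subfield_closed)
    then have "\<rho> (x * inverse x) = x * \<rho> (inverse x)"
      using x hom_on_mult[OF \<rho>, of x "inverse x"] by simp
    then have "\<rho> (inverse x) = inverse x" using x one by (simp add: field_simps)
    then show "inverse x \<in> ?M" using \<open>inverse x \<in> K\<close> by simp
  qed
  define t where "t = u - \<rho> u"
  have t: "t \<in> K" "t \<noteq> 0" "\<rho> t = - t"
    using nontriv clo K invol hom_on_diff[OF K \<rho>] by (auto simp: t_def subfield_closed)
  then have "t ^ 2 \<in> ?M"
    using K hom_on_mult[OF \<rho>, of t t] by (simp add: subfield_closed power2_eq_square)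
  moreover have "K = adjoin_sqrt ?M t"
  proof
    show "adjoin_sqrt ?M t \<subseteq> K" using K t by (intro adjoin_sqrt_least) auto
    show "K \<subseteq> adjoin_sqrt ?M t"
    proof
      fix y assume y: "y \<in> K"
      have two: "2 \<in> ?M" using add_in_subfield[OF M one_in_subfield[OF M] one_in_subfield[OF M]] by simp
      have ry: "\<rho> y \<in> K" "\<rho> (\<rho> y) = y" using clo invol y by simp_all
      have a: "y + \<rho> y \<in> ?M"
        using y ry K hom_on_add[OF \<rho>, of y "\<rho> y"] by (simp add: subfield_closed add.commute)
      have "(y - \<rho> y) * t \<in> K" using y ry K t by (simp add: subfield_closed)
      moreover have "\<rho> ((y - \<rho> y) * t) = (y - \<rho> y) * t"
        using y ry K t by (simp add: subfield_closed hom_on_mult[OF \<rho>] hom_on_diff[OF K \<rho>] algebra_simps)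
      ultimately have b: "(y - \<rho> y) * t \<in> ?M" by simp
      have eq: "y = (y + \<rho> y) / 2 + ((y - \<rho> y) * t / (2 * t ^ 2)) * t"
        using t(2) by (simp add: field_simps power2_eq_square)
      show "y \<in> adjoin_sqrt ?M t"
        using eq divide_in_subfield[OF M a two]
          divide_in_subfield[OF M b mult_in_subfield[OF M two \<open>t ^ 2 \<in> ?M\<close>]]
        by (rule adjoin_sqrtI)
    qed
  qed
  ultimately show ?thesis using M unfolding quad_step_def by blast
qed

text \<open>This is the descent step. Write \<open>L = F(s)\<close> and \<open>E = K(s)\<close>. The conjugation \<open>\<sigma>\<close> of \<open>E\<close> over \<open>K\<close>
  sends \<open>s\<close> to \<open>- s\<close>, hence maps \<open>L\<close> to itself and normalises the finite group of automorphisms of \<open>E\<close>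
  over \<open>L\<close>. The last step of the tower from \<open>L\<close> to \<open>E\<close> gives an involution \<open>\<tau>\<close> in that group, but \<open>\<tau>\<close>
  need not preserve \<open>K\<close>. An involution \<open>\<rho>\<close> that commutes with \<open>\<sigma>\<close> does preserve \<open>K\<close>, the fixed field of
  \<open>\<sigma>\<close>, and it acts nontrivially there, since \<open>E\<close> is generated by \<open>K\<close> and the element \<open>s\<close> that \<open>\<rho>\<close> fixes.\<close>

lemma quadratic_subfield:
  fixes K :: "'a::field_char_0 set"
  assumes F: "type_subfield F" and K: "type_subfield K" and FK: "F \<subseteq> K"
    and s: "s ^ 2 \<in> F" "s \<notin> K"
    and tower: "sqrt_tower (adjoin_sqrt F s) (adjoin_sqrt K s)"
    and neq: "adjoin_sqrt F s \<noteq> adjoin_sqrt K s"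
  obtains K' where "quad_step K' K" "F \<subseteq> K'" "K' \<noteq> K"
proof -
  define L E where "L = adjoin_sqrt F s" and "E = adjoin_sqrt K s"
  have L: "type_subfield L" using F s by (simp add: L_def subfield_adjoin_sqrt)
  have sK: "s ^ 2 \<in> K" using s FK by blast
  have E: "type_subfield E" using K sK by (simp add: E_def subfield_adjoin_sqrt)
  have sub: "F \<subseteq> L" "s \<in> L" "L \<subseteq> E" "K \<subseteq> E"
    using F K sqrt_tower_subset[OF tower]
    by (simp_all add: L_def E_def subset_adjoin_sqrt mem_adjoin_sqrt)
  obtain \<sigma> where \<sigma>: "\<sigma> \<in> automorphisms K E" "\<sigma> s = - s" "\<sigma> \<circ> \<sigma> = id"
    "\<And>x. x \<in> E \<Longrightarrow> \<sigma> x = x \<Longrightarrow> x \<in> K"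
    using sqrt_conjugation[OF K sK s(2)] unfolding E_def by metis
  obtain \<tau> where \<tau>: "\<tau> \<in> automorphisms L E" "\<tau> \<noteq> id" "\<tau> \<circ> \<tau> = id"
  proof -
    obtain N t where N: "sqrt_tower L N" "type_subfield N" "t ^ 2 \<in> N" "t \<notin> N" "E = adjoin_sqrt N t"
      using sqrt_tower_last_step[OF tower neq] unfolding L_def E_def by metis
    obtain \<tau> where \<tau>: "\<tau> \<in> automorphisms N E" "\<tau> t = - t" "\<tau> \<circ> \<tau> = id"
      using sqrt_conjugation[OF N(2-4)] N(5) by metis
    have "t \<noteq> 0" using N by (auto simp: subfield_closed)
    then have "\<tau> \<noteq> id" using \<tau>(2) by auto
    moreover have "\<tau> \<in> automorphisms L E"
      using \<tau>(1) sqrt_tower_subset[OF N(1)] by (auto simp: automorphisms_def)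
    ultimately show thesis using that \<tau>(3) by blast
  qed
  have normal: "\<sigma> \<circ> x \<circ> \<sigma> \<in> automorphisms L E" if x: "x \<in> automorphisms L E" for x
  proof -
    note \<sigma>D = automorphismsD[OF \<sigma>(1)] and xD = automorphismsD[OF x]
    have "\<sigma> \<in> automorphisms {} E" "x \<in> automorphisms {} E"
      using \<sigma>(1) x by (auto simp: automorphisms_def)
    then have "\<sigma> \<circ> x \<circ> \<sigma> \<in> automorphisms {} E" by (intro comp_automorphism)
    moreover have "(\<sigma> \<circ> x \<circ> \<sigma>) y = y" if y: "y \<in> L" for y
    proof -
      obtain a b where ab: "a \<in> F" "b \<in> F" "y = a + b * s"
        using y unfolding L_def by (rule adjoin_sqrtE)
      have "\<sigma> y = \<sigma> a + \<sigma> b * \<sigma> s"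
        using ab sub mult_in_subfield[OF E]
        by (simp add: hom_on_add[OF \<sigma>D(2)] hom_on_mult[OF \<sigma>D(2)] subset_iff)
      also have "\<dots> = a - b * s" using ab FK \<sigma>(2) \<sigma>D(3) by (simp add: subset_iff)
      finally have "\<sigma> y \<in> L"
        using ab sub mult_in_subfield[OF L] diff_in_subfield[OF L] by (simp add: subset_iff)
      then have "x (\<sigma> y) = \<sigma> y" by (rule xD(3))
      then show ?thesis using \<sigma>(3) by (simp add: fun_eq_iff)
    qed
    ultimately show ?thesis by (simp add: automorphisms_def)
  qed
  obtain \<rho> where \<rho>: "\<rho> \<in> automorphisms L E" "\<rho> \<noteq> id" "\<rho> \<circ> \<rho> = id" "\<rho> \<circ> \<sigma> = \<sigma> \<circ> \<rho>"
  proof (rule commuting_involution[of "automorphisms L E" \<tau> \<sigma>])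
    show "finite (automorphisms L E)"
      using finite_automorphisms tower L by (simp add: L_def E_def)
    show "inv_into UNIV x \<in> automorphisms L E" if "x \<in> automorphisms L E" for x
      using E sub(3) that by (rule inv_automorphism)
    show "bij x" if "x \<in> automorphisms L E" for x
      using automorphismsD(1)[OF that] by (rule permutes_bij)
  qed (use that id_automorphism comp_automorphism \<tau> \<sigma> normal in \<open>auto\<close>)
  note \<rho>D = automorphismsD[OF \<rho>(1)] and \<sigma>D = automorphismsD[OF \<sigma>(1)]
  have \<rho>K: "\<rho> x \<in> K" if x: "x \<in> K" for x
  proof (rule \<sigma>(4))
    show "\<rho> x \<in> E" using x sub \<rho>D(5) by blast
    show "\<sigma> (\<rho> x) = \<rho> x" using \<rho>(4) \<sigma>D(3)[OF x] by (metis comp_apply)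
  qed
  obtain u where u: "u \<in> K" "\<rho> u \<noteq> u"
  proof -
    have False if fixed: "\<And>x. x \<in> K \<Longrightarrow> \<rho> x = x"
    proof -
      have "\<rho> y = y" for y
      proof (cases "y \<in> E")
        case True
        then obtain a b where ab: "a \<in> K" "b \<in> K" "y = a + b * s"
          unfolding E_def by (rule adjoin_sqrtE)
        have mem: "a \<in> E" "b \<in> E" "s \<in> E" using ab sub by auto
        then have "\<rho> y = \<rho> a + \<rho> b * \<rho> s"
          using ab mult_in_subfield[OF E]
          by (simp add: hom_on_add[OF \<rho>D(2)] hom_on_mult[OF \<rho>D(2)])
        then show ?thesis using ab fixed \<rho>D(3)[OF sub(2)] by simp
      qed (rule \<rho>D(4))
      then show False using \<rho>(2) by (auto simp: fun_eq_iff)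
    qed
    then show thesis using that by blast
  qed
  have "quad_step {x \<in> K. \<rho> x = x} K"
  proof (rule quad_step_fixed_field)
    show "hom_on K \<rho>" using \<rho>D(2) sub(4) by (rule hom_on_subset)
    show "\<rho> (\<rho> x) = x" for x using \<rho>(3) by (simp add: fun_eq_iff)
    show "\<rho> 1 = 1" using L by (intro \<rho>D(3)) (rule one_in_subfield)
  qed (use K \<rho>K u in auto)
  moreover have "F \<subseteq> {x \<in> K. \<rho> x = x}" using FK sub(1) \<rho>D(3) by blast
  moreover have "{x \<in> K. \<rho> x = x} \<noteq> K" using u by blast
  ultimately show thesis by (rule that)
qed

section \<open>Subfields of towers of square roots\<close>

lemma (in ring) dim_proper_subspace_less:
  assumes K: "subfield K R" and E: "finite_dimension K E" and V: "subalgebra K V R" "V \<subset> E"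
  shows "dim K V < dim K E"
proof -
  have n: "dimension (dim K E) K E"
    using finite_dimensionE[OF K E] by (simp add: over_def)
  have "finite_dimension K V"
    using subalbegra_incl_imp_finite_dimension[OF K E V(1)] V(2) by blast
  then have "dimension (dim K V) K V"
    using finite_dimensionE[OF K] by (simp add: over_def)
  then obtain Vs where Vs: "set Vs \<subseteq> carrier R" "independent K Vs" "length Vs = dim K V" "Span K Vs = V"
    using exists_base[OF K] by blast
  have "set Vs \<subseteq> E" using Span_base_incl[OF K Vs(1)] Vs(4) V(2) by blast
  then show ?thesis
    using independent_length_le_dimension[OF K n Vs(2)] independent_length_eq_dimension[OF K n Vs(2)] Vs V(2)
    by auto
qed

lemma (in ring) subfield_is_subalgebra:
  assumes "subfield K R" "F \<subseteq> K"
  shows "subalgebra F K R"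
  using subringE(6)[OF subfieldE(1)[OF assms(1)]] subring.axioms(1)[OF subfieldE(1)[OF assms(1)]] assms(2)
  by (auto simp: subalgebra_def subalgebra_axioms_def)

text \<open>The outer induction removes the bottom step \<open>F \<subseteq> F(s)\<close> of the tower, so that every field between
  \<open>F(s)\<close> and \<open>L\<close>, in particular \<open>K(s)\<close>, is known to be a tower over \<open>F(s)\<close>. Descent then replaces \<open>K\<close> by
  a proper subfield, and the inner induction is on the degree of \<open>K\<close> over \<open>F\<close>.\<close>

proposition intermediate_field_sqrt_tower:
  fixes F :: "'a::field_char_0 set"
  assumes "sqrt_tower F L" "type_subfield F" "type_subfield K" "F \<subseteq> K" "K \<subseteq> L"
  shows "sqrt_tower F K"
  using assms
proof (induction arbitrary: K rule: converse_rtranclp_induct)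
  case base
  then show ?case by simp
next
  case (step F F')
  obtain s where s: "s ^ 2 \<in> F" "F' = adjoin_sqrt F s"
    using step.hyps(1) by (auto simp: quad_step_def)
  have F: "type_subfield F" by fact
  have F': "type_subfield F'" using step.hyps(1) by (rule quad_step_subfield)
  have L: "type_subfield L" using step.hyps(2) F' by (rule sqrt_tower_subfield)
  have F'L: "F' \<subseteq> L" using step.hyps(2) by (rule sqrt_tower_subset)
  have finL: "ring.finite_dimension ring_of_type_algebra F L"
    using converse_rtranclp_into_rtranclp[OF step.hyps] F by (rule sqrt_tower_finite_dimension)
  show ?case
    using step.prems(2-4)
  proof (induction "ring.dim ring_of_type_algebra F K" arbitrary: K rule: less_induct)
    case (less K)
    have sK: "s ^ 2 \<in> K" using s(1) less.prems(2) by blast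
    show ?case
    proof (cases "s \<in> K")
      case True
      then have "F' \<subseteq> K" unfolding s(2) using less.prems by (intro adjoin_sqrt_least)
      then have "sqrt_tower F' K" using step.IH F' less.prems by blast
      with step.hyps(1) show ?thesis by (rule converse_rtranclp_into_rtranclp)
    next
      case False
      let ?E = "adjoin_sqrt K s"
      have E: "type_subfield ?E" using less.prems(1) sK by (rule subfield_adjoin_sqrt)
      have "F' \<subseteq> ?E"
        unfolding s(2) using less.prems E
        by (intro adjoin_sqrt_least subset_trans[OF _ subset_adjoin_sqrt] mem_adjoin_sqrt)
      moreover have "?E \<subseteq> L"
        using L less.prems(3) F'L mem_adjoin_sqrt[OF F, of s] s(2) by (intro adjoin_sqrt_least) auto
      ultimately have tower: "sqrt_tower F' ?E" using step.IH F' E by blast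
      show ?thesis
      proof (cases "F' = ?E")
        case True
        \<comment> \<open>Here \<open>K \<subseteq> F(s)\<close> but \<open>s \<notin> K\<close>, so the coefficient of \<open>s\<close> in an element of \<open>K\<close> is zero.\<close>
        have "K \<subseteq> F"
        proof
          fix x assume x: "x \<in> K"
          then have "x \<in> F'" using True subset_adjoin_sqrt[OF less.prems(1)] by blast
          then obtain a b where ab: "a \<in> F" "b \<in> F" "x = a + b * s"
            unfolding s(2) by (rule adjoin_sqrtE)
          then have "a \<in> K" "b \<in> K" using less.prems(2) by auto
          then have "b = 0"
            using adjoin_sqrt_unique(2)[OF less.prems(1) False, of x 0 a b] x ab less.prems(1)
            by (simp add: subfield_closed)
          then show "x \<in> F" using ab by simp
        qed
        then show ?thesis using less.prems(2) by auto
      next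
        case neq: False
        obtain K' where K': "quad_step K' K" "F \<subseteq> K'" "K' \<noteq> K"
          using quadratic_subfield[OF F less.prems(1,2) s(1) False] tower neq unfolding s(2) by metis
        have sub: "type_subfield K'" "K' \<subseteq> K"
          using K'(1) quad_step_subset by (auto simp: quad_step_def)
        have "subalgebra F K ring_of_type_algebra"
          using less.prems by (intro type_ring.subfield_is_subalgebra)
        then have "ring.finite_dimension ring_of_type_algebra F K"
          using type_ring.subalbegra_incl_imp_finite_dimension[OF F finL] less.prems(3) by blast
        then have "ring.dim ring_of_type_algebra F K' < ring.dim ring_of_type_algebra F K"
          using F sub K' by (intro type_ring.dim_proper_subspace_less type_ring.subfield_is_subalgebra) auto
        then have "sqrt_tower F K'"
          using less.hyps sub K'(2) less.prems(3) by blast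
        then show ?thesis using K'(1) by (rule rtranclp.rtrancl_into_rtrancl)
      qed
    qed
  qed
qed

section \<open>Real radical extensions of two-power degree\<close>

text \<open>Polynomials over a subring are lists with the leading coefficient first.\<close>

lemma type_ring_eval:
  fixes p :: "'a::field list"
  shows "ring.eval ring_of_type_algebra p y = poly (Poly (rev p)) y"
proof (induction p)
  case (Cons a p)
  then show ?case by (simp add: Poly_append poly_monom algebra_simps)
qed simp

text \<open>Up to sign, the constant coefficient is the product of the roots.\<close>

lemma norm_coeff_0_of_equal_modulus_roots:
  fixes p :: "complex poly"
  assumes "lead_coeff p = 1" and "\<And>z. poly p z = 0 \<Longrightarrow> norm z = r"
  shows "norm (coeff p 0) = r ^ degree p"
proof -
  obtain A where A: "size A = degree p" "p = (\<Prod>z\<in>#A. [:- z, 1:])"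
    using alg_closed_imp_factorization[of p] assms(1) by fastforce
  have eval: "poly p x = (\<Prod>z\<in>#A. x - z)" for x
    by (subst A(2)) (simp add: poly_prod_mset)
  have norm: "norm z = r" if "z \<in># A" for z
    using that by (intro assms(2)) (auto simp: eval prod_mset_zero_iff)
  have "norm (coeff p 0) = norm (\<Prod>z\<in>#A. 0 - z)"
    by (simp only: eval[symmetric] poly_0_coeff_0)
  also have "\<dots> = (\<Prod>z\<in>#A. norm z)"
    by (induction A) (simp_all add: norm_mult)
  also have "\<dots> = (\<Prod>z\<in>#A. r)"
    using norm by (intro arg_cong[where f = prod_mset] image_mset_cong) auto
  also have "\<dots> = r ^ degree p" using A(1) by simp
  finally show ?thesis .
qed

text \<open>Let \<open>P\<close> be the minimal polynomial of \<open>x\<close> over \<open>F\<close>. It divides \<open>X^n - x^n\<close>, so each of its complex roots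
  has modulus \<open>\<bar>x\<bar>\<close>, and its constant coefficient, which lies in \<open>F\<close>, has modulus \<open>\<bar>x\<bar> ^ m\<close>. As that
  coefficient and \<open>x\<close> are real, it equals \<open>x ^ m\<close> up to sign.\<close>

lemma real_radical_power_dimension:
  fixes F :: "real set"
  assumes F: "type_subfield F" and n: "n > 0" "x ^ n \<in> F"
    and dim: "ring.dimension ring_of_type_algebra m F (ring.simple_extension ring_of_type_algebra F x)"
  shows "x ^ m \<in> F"
proof -
  let ?R = "ring_of_type_algebra :: real ring"
  have "ring.finite_dimension ?R F (ring.simple_extension ?R F x)"
    using dim by (rule type_ring.finite_dimensionI)
  then have alg: "(ring.algebraic ?R over F) x"
    using type_ring.finite_dimension_simple_extension[OF F, of x] by simp
  define I where "I = ring.Irr ?R F x"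
  have xR: "x \<in> carrier ?R" by simp
  note Irr = type_ring.IrrE[OF F xR alg, folded I_def]
  have m: "m = length I - 1"
    using type_ring.dimension_is_inj[OF F dim type_ring.dimension_simple_extension[OF F xR alg]]
    by (simp add: I_def)
  have "I \<noteq> []"
    using type_ring.pirreducible_degree[OF F Irr(1,2)] by auto
  moreover have "set I \<subseteq> F"
    using Irr(1) by (auto simp: univ_poly_def polynomial_def)
  ultimately obtain I' where I: "I = 1 # I'" "set I \<subseteq> F"
    using Irr(3) by (cases I) auto
  define P where "P = Poly (rev I)"
  have "coeffs P = rev I" by (simp add: P_def I)
  then have "degree P = m" by (simp add: degree_eq_length_coeffs m)
  have "P \<noteq> 0" using \<open>coeffs P = rev I\<close> I(1) by auto
  then have "last (coeffs P) = lead_coeff P" by (rule last_coeffs_eq_coeff_degree)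
  then have "lead_coeff P = 1" unfolding \<open>coeffs P = rev I\<close> by (simp add: I(1))
  note P = \<open>degree P = m\<close> \<open>lead_coeff P = 1\<close>
  have "coeff P 0 = rev I ! 0"
    by (simp add: P_def I(1) nth_default_nth)
  also have "\<dots> \<in> set (rev I)" by (rule nth_mem) (simp add: I(1))
  finally have P0: "coeff P 0 \<in> F" using I(2) by auto
  \<comment> \<open>The polynomial \<open>X^n - x^n\<close> as a coefficient list.\<close>
  define q where "q = 1 # replicate (n - 1) 0 @ [- (x ^ n)]"
  have evq: "ring.eval ?R q y = y ^ n - x ^ n" for y
    using n(1) type_ring.eval_replicate[of "[- (x ^ n)]" y "n - 1"] by (simp add: q_def)
  have q: "q \<in> carrier (univ_poly ?R F)"
    using F n by (auto simp: q_def univ_poly_def polynomial_def subfield_closed)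
  have "I pdivides\<^bsub>?R\<^esub> q"
    unfolding I_def using type_ring.Irr_minimal[OF F xR alg q] evq by simp
  then obtain r where r: "q = ring.poly_mult ?R I r"
    by (auto simp: pdivides_def factor_def univ_poly_mult)
  define Q where "Q = Poly (rev r)"
  \<comment> \<open>Real polynomials that agree at every point are equal, which turns the divisibility of lists into one
    that can be mapped to the complex numbers.\<close>
  have "poly (monom 1 n - [:x ^ n:]) y = poly (P * Q) y" for y
    using evq[of y] type_ring.eval_poly_mult[of I r y]
    by (simp add: r type_ring_eval P_def Q_def poly_monom)
  then have PQ: "monom 1 n - [:x ^ n:] = P * Q" by (intro poly_ext)
  have root: "norm z = \<bar>x\<bar>" if z: "poly (map_poly of_real P) z = 0" for z :: complex
  proof -
    let ?c = "map_poly of_real :: real poly \<Rightarrow> complex poly"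
    have "?c (P * Q) = ?c P * ?c Q"
      by (rule poly_eqI) (simp add: coeff_map_poly coeff_mult)
    moreover have "?c (monom 1 n - [:x ^ n:]) = monom 1 n - [:of_real (x ^ n):]"
      by (rule poly_eqI) (simp add: coeff_map_poly coeff_pCons split: nat.split)
    ultimately have "monom 1 n - [:of_real (x ^ n):] = ?c P * ?c Q" using PQ by simp
    then have "poly (monom 1 n - [:of_real (x ^ n):]) z = 0" using z by simp
    then have "z ^ n = of_real (x ^ n)" by (simp add: poly_monom)
    then have "norm z ^ n = \<bar>x\<bar> ^ n"
      by (metis norm_of_real norm_power power_abs)
    then show ?thesis using n(1) by (simp add: power_eq_iff_eq_base)
  qed
  have "\<bar>coeff P 0\<bar> = \<bar>x\<bar> ^ m"
    using norm_coeff_0_of_equal_modulus_roots[of "map_poly of_real P" "\<bar>x\<bar>"] root P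
    by (simp add: coeff_map_poly degree_map_poly)
  then have "\<bar>x ^ m\<bar> = \<bar>coeff P 0\<bar>" by (simp add: power_abs)
  then show ?thesis
    using P0 uminus_in_subfield[OF F P0] by (auto simp: abs_eq_iff)
qed

text \<open>Adjoin \<open>x ^ 2 ^ (j - 1)\<close>, \<open>\<dots>\<close>, \<open>x ^ 2\<close>, \<open>x\<close> one after the other.\<close>

lemma sqrt_tower_two_power_root:
  assumes F: "type_subfield F" and x: "x ^ 2 ^ j \<in> F"
  shows "sqrt_tower F (ring.simple_extension ring_of_type_algebra F x)"
  using x
proof (induction j arbitrary: x)
  case 0
  then have "ring.simple_extension ring_of_type_algebra F x = F"
    using F by (simp add: simple_extension_eq_adjoin_sqrt adjoin_sqrt_trivial subfield_closed)
  then show ?case by simp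
next
  case (Suc j)
  let ?R = "ring_of_type_algebra :: 'a ring"
  let ?M = "ring.simple_extension ?R F (x ^ 2)" and ?E = "ring.simple_extension ?R F x"
  note sub = subfieldE(1)[OF F]
  have tower: "sqrt_tower F ?M"
    using Suc.prems by (intro Suc.IH) (simp add: power_mult[symmetric])
  then have M: "type_subfield ?M" using F by (rule sqrt_tower_subfield)
  have xM: "x ^ 2 \<in> ?M" using type_ring.simple_extension_mem[OF sub] by simp
  have FM: "F \<subseteq> ?M" using type_ring.simple_extension_incl[of F "x ^ 2"] by simp
  have "?E = adjoin_sqrt ?M x"
  proof
    show "?E \<subseteq> adjoin_sqrt ?M x"
      using subfieldE(1)[OF subfield_adjoin_sqrt[OF M xM]] FM subset_adjoin_sqrt[OF M] mem_adjoin_sqrt[OF M]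
      by (intro type_ring.simple_extension_subring_incl) auto
    have E: "subring ?E ?R" "F \<subseteq> ?E" "x \<in> ?E"
      using type_ring.simple_extension_is_subring[OF sub] type_ring.simple_extension_incl[of F x]
        type_ring.simple_extension_mem[OF sub] by simp_all
    have "x ^ 2 \<in> ?E" using subringE(6)[OF E(1) E(3) E(3)] by (simp add: power2_eq_square)
    then have "?M \<subseteq> ?E" using E by (intro type_ring.simple_extension_subring_incl)
    show "adjoin_sqrt ?M x \<subseteq> ?E"
    proof
      fix y assume "y \<in> adjoin_sqrt ?M x"
      then obtain a b where ab: "a \<in> ?M" "b \<in> ?M" "y = a + b * x" by (rule adjoin_sqrtE)
      have "a \<in> ?E" "b * x \<in> ?E"
        using ab(1,2) \<open>?M \<subseteq> ?E\<close> subringE(6)[OF E(1) _ E(3), of b] by auto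
      then show "y \<in> ?E" using subringE(7)[OF E(1), of a "b * x"] ab(3) by simp
    qed
  qed
  then have "quad_step ?M ?E" using M xM by (auto simp: quad_step_def)
  with tower show ?case by (rule rtranclp.rtrancl_into_rtrancl)
qed

section \<open>Repeated radical extensions\<close>

text \<open>A chain of length zero has no step that would make \<open>F\<close> a subfield, hence the separate conjunct.\<close>

lemma (in ring) repeated_radical_extension_iff:
  "repeated_radical_extension F L \<longleftrightarrow> subfield F R \<and> radical_extension\<^sup>*\<^sup>* F L"
proof
  assume "repeated_radical_extension F L"
  then show "subfield F R \<and> radical_extension\<^sup>*\<^sup>* F L"
    unfolding repeated_radical_extension_def
  proof (elim exE conjE)
    fix r :: nat and E :: "nat \<Rightarrow> 'a set" assume E: "E 0 = F" "E r = L" "\<forall>i\<le>r. subfield (E i) R"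
      "\<forall>i. 0 < i \<and> i \<le> r \<longrightarrow> radical_extension (E (i - 1)) (E i)"
    have "\<forall>i<r. radical_extension (E i) (E (Suc i))"
      using E(4) by (metis Suc_leI diff_Suc_1 zero_less_Suc)
    then have "(radical_extension ^^ r) F L"
      unfolding relpowp_fun_conv using E(1,2) by (intro exI[of _ E] conjI)
    moreover have "subfield F R" using E(1,3) by blast
    ultimately show ?thesis by (blast dest: relpowp_imp_rtranclp)
  qed
next
  assume FL: "subfield F R \<and> radical_extension\<^sup>*\<^sup>* F L"
  then obtain r where "(radical_extension ^^ r) F L" by (blast dest: rtranclp_imp_relpowp)
  then show "repeated_radical_extension F L"
    unfolding relpowp_fun_conv
  proof (elim exE conjE)
    fix E :: "nat \<Rightarrow> 'a set" assume E: "E 0 = F" "E r = L" "\<forall>i<r. radical_extension (E i) (E (Suc i))"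
    have step: "radical_extension (E (i - 1)) (E i)" if "0 < i" "i \<le> r" for i
      using E(3)[rule_format, of "i - 1"] that by simp
    have "subfield (E i) R" if "i \<le> r" for i
    proof (cases "i = 0")
      case True
      then show ?thesis using FL E(1) by simp
    next
      case False
      then show ?thesis using step[of i] that by (simp add: radical_extension_def)
    qed
    then show ?thesis
      unfolding repeated_radical_extension_def
      using E(1,2) step by (intro exI[of _ r] exI[of _ E]) simp
  qed
qed

lemma quad_step_imp_radical_extension:
  assumes "quad_step F E"
  shows "ring.radical_extension ring_of_type_algebra F E"
proof -
  obtain s where s: "type_subfield F" "s ^ 2 \<in> F" "E = adjoin_sqrt F s"
    using assms by (auto simp: quad_step_def)
  have "s [^]\<^bsub>ring_of_type_algebra\<^esub> (2::nat) \<in> F" using s by simp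
  moreover have "E = ring.simple_extension ring_of_type_algebra F s"
    using s by (simp add: simple_extension_eq_adjoin_sqrt)
  ultimately show ?thesis
    unfolding type_ring.radical_extension_def
    using s(1) mem_adjoin_sqrt[OF s(1), of s, folded s(3)]
      quad_step_subfield[OF assms] quad_step_subset[OF assms]
    by (intro conjI bexI[of _ s] exI[of _ "2::nat"]) simp_all
qed

lemma radical_extension_finite_dimension:
  fixes F E :: "'a::field set"
  assumes "ring.radical_extension ring_of_type_algebra F E"
  shows "ring.finite_dimension ring_of_type_algebra F E"
proof -
  obtain x where F: "type_subfield F" and E: "type_subfield E" "E = ring.simple_extension ring_of_type_algebra F x"
    using assms unfolding type_ring.radical_extension_def by (elim conjE bexE exE) (rule that)
  then show ?thesis
    using type_ring.finite_dimension_simple_extension[OF F, of x]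
      type_ring.simple_extension_is_subfield[OF F, of x] by simp
qed

lemma radical_tower_finite_dimension:
  fixes F L :: "'a::field set"
  assumes "(ring.radical_extension ring_of_type_algebra)\<^sup>*\<^sup>* F L" "type_subfield F"
  shows "type_subfield L \<and> ring.finite_dimension ring_of_type_algebra F L"
  using assms
proof (induction rule: rtranclp_induct)
  case base
  then show ?case using type_ring.dimension_one type_ring.finite_dimensionI by blast
next
  case (step M L)
  then have "type_subfield M" "ring.finite_dimension ring_of_type_algebra F M" by simp_all
  moreover have "ring.finite_dimension ring_of_type_algebra M L" "type_subfield L"
    using radical_extension_finite_dimension[OF step.hyps(2)] step.hyps(2)
    unfolding type_ring.radical_extension_def by simp_all
  ultimately show ?case
    using type_ring.telescopic_base_dim(1)[OF step.prems] by blast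
qed

text \<open>Degrees multiply along the tower, so each of them divides \<open>2 ^ k\<close> and is a power of two itself. Each
  step therefore adjoins a root of two-power exponent.\<close>

lemma real_radical_tower_is_sqrt_tower:
  fixes F L :: "real set"
  assumes "(ring.radical_extension ring_of_type_algebra)\<^sup>*\<^sup>* F L" "type_subfield F"
    and "ring.dimension ring_of_type_algebra (2 ^ k) F L"
  shows "sqrt_tower F L"
  using assms
proof (induction arbitrary: k rule: converse_rtranclp_induct)
  case (step F M)
  let ?R = "ring_of_type_algebra :: real ring"
  obtain x n where x: "n > (0::nat)" "x ^ n \<in> F" "M = ring.simple_extension ?R F x" and M: "type_subfield M"
    using step.hyps(1) by (auto simp: type_ring.radical_extension_def)
  obtain m l where m: "ring.dimension ?R m F M" and l: "ring.dimension ?R l M L"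
    using radical_extension_finite_dimension[OF step.hyps(1)]
      radical_tower_finite_dimension[OF step.hyps(2) M]
    by (auto simp: type_ring.finite_dimension_def)
  have "m * l = 2 ^ k"
    using type_ring.telescopic_base[OF step.prems(1) M m l]
      type_ring.dimension_is_inj[OF step.prems(1) _ step.prems(2)] by blast
  then have "m dvd 2 ^ k" "l dvd 2 ^ k" by (metis dvd_triv_left, metis dvd_triv_right)
  then obtain i j where ij: "m = 2 ^ i" "l = 2 ^ j"
    by (auto simp: divides_primepow_nat)
  have "x ^ m \<in> F"
    using real_radical_power_dimension[OF step.prems(1) x(1,2)] m x(3) by simp
  then have "sqrt_tower F M"
    unfolding x(3) ij(1) by (rule sqrt_tower_two_power_root[OF step.prems(1)])
  moreover have "sqrt_tower M L" using step.IH[OF M] l ij(2) by simp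
  ultimately show ?case by (rule rtranclp_trans)
qed simp

theorem theoremD:
  fixes K L :: "real set"
  assumes "ring.repeated_radical_extension real_ring \<rat> L"
    and "\<exists>k::nat. ring.dimension real_ring (2 ^ k) \<rat> L"
    and "subfield K real_ring"
    and "\<rat> \<subseteq> K" and "K \<subseteq> L"
  shows "ring.repeated_radical_extension real_ring \<rat> K"
proof -
  have Q: "type_subfield (\<rat> :: real set)"
    and L: "(ring.radical_extension real_ring)\<^sup>*\<^sup>* \<rat> L"
    using assms(1) by (simp_all add: type_ring.repeated_radical_extension_iff)
  obtain k where "ring.dimension real_ring (2 ^ k) \<rat> L" using assms(2) by blast
  with L Q have "sqrt_tower \<rat> L" by (intro real_radical_tower_is_sqrt_tower)
  then have "sqrt_tower \<rat> K"
    using Q assms(3-5) by (rule intermediate_field_sqrt_tower)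
  then have "(ring.radical_extension real_ring)\<^sup>*\<^sup>* \<rat> K"
    using mono_rtranclp[of quad_step "ring.radical_extension real_ring"]
      quad_step_imp_radical_extension by blast
  with Q show ?thesis by (simp add: type_ring.repeated_radical_extension_iff)
qed

end
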